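(* Let $i,j$ be delay conditions and let $k=i\circ j$ be their serial connection, $k(u)=\{y\mid \exists x,\ x\in j(u)\text{ and }y\in i(x)\}$. Then: (a) $k$ is a delay condition; (b) if $i,j$ are deterministic, then $k$ is deterministic; (c) if $i,j$ are time invariant, then $k$ is time invariant; (d) if $i,j$ are symmetrical, then $k$ is symmetrical.
   Context: $\mathbf{B}=\{0,1\}$ with complement $\overline{\,\cdot\,}$ (extended pointwise to functions). A signal is a function $x:\mathbf{R}\rightarrow\mathbf{B}$ for which there exists an unbounded sequence $0\leq t_0<t_1<t_2<\dots$ of reals such that $x$ is constant on $(-\infty,t_0)$ and on each interval $[t_k,t_{k+1})$. $S$ is the set of signals, $P^*(S)$ the set of non-empty subsets of $S$, and $\tau^d(t)=t-d$. For $u,x\in S$, $(u,x)$ satisfies the stability condition (SC) if for every $a\in\mathbf{B}$: if $u(t)=a$ for all sufficiently large $t$, then $x(t)=a$ for all sufficiently large $t$; $Sol_{SC}(u)=\{x\in S\mid(u,x)\text{ satisfies SC}\}$. A delay condition (DC) is a function $i:S\rightarrow P^*(S)$ with $i(u)\subset Sol_{SC}(u)$ for all $u$. A DC $i$ is deterministic if each $i(u)$ has exactly one element. A DC $i$ is time invariant if for all $u\in S$, all $x$ and all $d\in\mathbf{R}$: if $u\circ\tau^d\in S$ and $x\in i(u)$ then $x\circ\tau^d\in S$ and $x\circ\tau^d\in i(u\circ\tau^d)$. A DC $i$ is (rising-falling) symmetrical if for all $u\in S$, $i(\overline{u})=\{\overline{x}\mid x\in i(u)\}$. *)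

theory Defs
  imports "HOL-Analysis.Analysis"
begin

text \<open>
  The set \<open>B = {0,1}\<close> is rendered by \<^typ>\<open>bool\<close>. The complement of a signal is the pointwise
  boolean complement \<open>- x\<close> on the function type \<open>real \<Rightarrow> bool\<close>. Functions with domain
  \<open>S\<close> are total functions whose values outside \<open>S\<close> are irrelevant: every condition
  below only constrains arguments in \<open>S\<close>.
\<close>

definition signals :: "(real \<Rightarrow> bool) set" where
  "signals = {x. \<exists>t :: nat \<Rightarrow> real.
      0 \<le> t 0 \<and> strict_mono t \<and> \<not> bdd_above (range t) \<and>
      x constant_on {..<t 0} \<and> (\<forall>k. x constant_on {t k..<t (Suc k)})}"

definition translation :: "real \<Rightarrow> real \<Rightarrow> real" where
  "translation d t = t - d"

definition satisfies_SC :: "(real \<Rightarrow> bool) \<Rightarrow> (real \<Rightarrow> bool) \<Rightarrow> bool" where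
  "satisfies_SC u x \<longleftrightarrow>
    (\<forall>a. (\<forall>\<^sub>F t in at_top. u t = a) \<longrightarrow> (\<forall>\<^sub>F t in at_top. x t = a))"

definition Sol_SC :: "(real \<Rightarrow> bool) \<Rightarrow> (real \<Rightarrow> bool) set" where
  "Sol_SC u = {x \<in> signals. satisfies_SC u x}"

definition delay_condition :: "((real \<Rightarrow> bool) \<Rightarrow> (real \<Rightarrow> bool) set) \<Rightarrow> bool" where
  "delay_condition i \<longleftrightarrow>
    i \<in> signals \<rightarrow> Pow signals - {{}} \<and> (\<forall>u\<in>signals. i u \<subseteq> Sol_SC u)"

definition deterministic :: "((real \<Rightarrow> bool) \<Rightarrow> (real \<Rightarrow> bool) set) \<Rightarrow> bool" where
  "deterministic i \<longleftrightarrow> (\<forall>u\<in>signals. \<exists>!x. x \<in> i u)"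

definition time_invariant :: "((real \<Rightarrow> bool) \<Rightarrow> (real \<Rightarrow> bool) set) \<Rightarrow> bool" where
  "time_invariant i \<longleftrightarrow>
    (\<forall>u\<in>signals. \<forall>x d. u \<circ> translation d \<in> signals \<and> x \<in> i u \<longrightarrow>
      x \<circ> translation d \<in> signals \<and> x \<circ> translation d \<in> i (u \<circ> translation d))"

definition symmetrical :: "((real \<Rightarrow> bool) \<Rightarrow> (real \<Rightarrow> bool) set) \<Rightarrow> bool" where
  "symmetrical i \<longleftrightarrow> (\<forall>u\<in>signals. i (- u) = {- x | x. x \<in> i u})"

definition serial_connection ::
  "((real \<Rightarrow> bool) \<Rightarrow> (real \<Rightarrow> bool) set) \<Rightarrow> ((real \<Rightarrow> bool) \<Rightarrow> (real \<Rightarrow> bool) set) \<Rightarrow>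
   (real \<Rightarrow> bool) \<Rightarrow> (real \<Rightarrow> bool) set" where
  "serial_connection i j u = {y. \<exists>x. x \<in> j u \<and> y \<in> i x}"

end

theory Submission
  imports Defs
begin

text \<open>A serial connection feeds every intermediate state \<open>x\<close> of
  \<open>j u\<close> into \<open>i\<close>, so its value at \<open>u\<close> is the union of the
  sets \<open>i x\<close> over \<open>x\<close> in \<open>j u\<close>. The properties of
  \<open>i\<close> are only known at signals; the bridge is \<open>delay_condition_signals\<close>,
  by which each such \<open>x\<close> is itself a signal, so that they apply at \<open>x\<close>.
  Each claim then passes through the two stages: stability composes by
  \<open>satisfies_SC_trans\<close>, singletons compose to singletons, a translation is carried from
  input to intermediate state to output, and complementation commutes with the union.\<close>

lemma delay_condition_iff:
  "delay_condition i \<longleftrightarrow> (\<forall>u\<in>signals. i u \<noteq> {} \<and> i u \<subseteq> Sol_SC u)"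
  by (auto simp: delay_condition_def Sol_SC_def Pi_iff)

lemma delay_condition_signals:
  assumes "delay_condition i" "u \<in> signals" "x \<in> i u"
  shows "x \<in> signals"
  using assms unfolding delay_condition_iff Sol_SC_def by blast

lemma delay_condition_nonempty:
  assumes "delay_condition i" "u \<in> signals"
  obtains x where "x \<in> i u"
  using assms unfolding delay_condition_iff Sol_SC_def by blast

lemma delay_condition_satisfies_SC:
  assumes "delay_condition i" "u \<in> signals" "x \<in> i u"
  shows "satisfies_SC u x"
  using assms unfolding delay_condition_iff Sol_SC_def by blast

text \<open>For each fixed \<open>a\<close>, stability is an implication between eventual constancy
  of input and of output with that same value \<open>a\<close>, so the two implications
  chain.\<close>

lemma satisfies_SC_trans:
  assumes "satisfies_SC u x" "satisfies_SC x y"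
  shows "satisfies_SC u y"
  using assms unfolding satisfies_SC_def by simp

lemma mem_serial_connection:
  "y \<in> serial_connection i j u \<longleftrightarrow> (\<exists>x\<in>j u. y \<in> i x)"
  unfolding serial_connection_def by blast

lemma delay_condition_serial_connection:
  assumes i: "delay_condition i" and j: "delay_condition j"
  shows "delay_condition (serial_connection i j)"
proof -
  have "serial_connection i j u \<noteq> {} \<and> serial_connection i j u \<subseteq> Sol_SC u"
    if u: "u \<in> signals" for u
  proof
    obtain x where x: "x \<in> j u" using delay_condition_nonempty[OF j u] .
    obtain y where "y \<in> i x"
      using delay_condition_nonempty[OF i delay_condition_signals[OF j u x]] .
    with x show "serial_connection i j u \<noteq> {}"
      using mem_serial_connection by blast
    show "serial_connection i j u \<subseteq> Sol_SC u"
    proof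
      fix y assume "y \<in> serial_connection i j u"
      then obtain x where x: "x \<in> j u" and y: "y \<in> i x"
        using mem_serial_connection by blast
      have xs: "x \<in> signals" using delay_condition_signals[OF j u x] .
      show "y \<in> Sol_SC u"
        unfolding Sol_SC_def
        using delay_condition_signals[OF i xs y]
          satisfies_SC_trans[OF delay_condition_satisfies_SC[OF j u x]
            delay_condition_satisfies_SC[OF i xs y]]
        by blast
    qed
  qed
  then show ?thesis
    unfolding delay_condition_iff by blast
qed

text \<open>The union over intermediate states collapses to the single set \<open>i x\<close>, and
  \<open>x\<close> is a signal, where determinism of \<open>i\<close> can be used.\<close>

lemma deterministic_serial_connection:
  assumes j: "delay_condition j" and "deterministic i" "deterministic j"
  shows "deterministic (serial_connection i j)"
  unfolding deterministic_def
proof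
  fix u assume u: "u \<in> signals"
  then obtain x where x: "x \<in> j u" and x_unique: "\<And>x'. x' \<in> j u \<Longrightarrow> x' = x"
    using assms(3) unfolding deterministic_def by (metis (lifting))
  have "j u = {x}" using x x_unique by blast
  then have "serial_connection i j u = i x"
    unfolding serial_connection_def by simp
  moreover have "\<exists>!y. y \<in> i x"
    using assms(2) delay_condition_signals[OF j u x] unfolding deterministic_def by simp
  ultimately show "\<exists>!y. y \<in> serial_connection i j u"
    by simp
qed

text \<open>If \<open>x\<close> links \<open>u\<close> to \<open>y\<close>, then the translate of
  \<open>x\<close> links the translate of \<open>u\<close> to that of \<open>y\<close>.\<close>

lemma time_invariant_serial_connection:
  assumes j: "delay_condition j" and "time_invariant i" "time_invariant j"
  shows "time_invariant (serial_connection i j)"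
  unfolding time_invariant_def
proof (intro ballI allI impI, elim conjE)
  fix u y d
  assume u: "u \<in> signals" and ud: "u \<circ> translation d \<in> signals"
    and "y \<in> serial_connection i j u"
  then obtain x where x: "x \<in> j u" and y: "y \<in> i x"
    using mem_serial_connection by blast
  have xs: "x \<in> signals" using delay_condition_signals[OF j u x] .
  have xd: "x \<circ> translation d \<in> signals" "x \<circ> translation d \<in> j (u \<circ> translation d)"
    using assms(3) u ud x unfolding time_invariant_def by blast+
  \<comment> \<open>Time invariance of \<open>i\<close> at \<open>x\<close> presupposes that the
    translate of \<open>x\<close> is a signal; time invariance of \<open>j\<close> has just supplied
    this as \<open>xd(1)\<close>.\<close>
  have "y \<circ> translation d \<in> signals" "y \<circ> translation d \<in> i (x \<circ> translation d)"
    using assms(2) xs xd(1) y unfolding time_invariant_def by blast+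
  with xd(2) show "y \<circ> translation d \<in> signals \<and>
      y \<circ> translation d \<in> serial_connection i j (u \<circ> translation d)"
    unfolding mem_serial_connection by blast
qed

lemma symmetrical_serial_connection:
  assumes j: "delay_condition j" and "symmetrical i" "symmetrical j"
  shows "symmetrical (serial_connection i j)"
  unfolding symmetrical_def
proof
  fix u assume u: "u \<in> signals"
  have ju: "j (- u) = {- x | x. x \<in> j u}"
    using assms(3) u unfolding symmetrical_def by blast
  have ix: "i (- x) = {- y | y. y \<in> i x}" if "x \<in> j u" for x
    using assms(2) delay_condition_signals[OF j u that] unfolding symmetrical_def by blast
  \<comment> \<open>The intermediate states for \<open>- u\<close> are reindexed as
    \<open>- x\<close> with \<open>x\<close> in \<open>j u\<close>, so that symmetry of
    \<open>i\<close> can be used at the signal \<open>x\<close> in each member of the union.\<close>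
  have "serial_connection i j (- u) = (\<Union>x\<in>j u. i (- x))"
    unfolding serial_connection_def ju by blast
  also have "\<dots> = (\<Union>x\<in>j u. {- y | y. y \<in> i x})"
    by (rule SUP_cong) (simp_all add: ix)
  also have "\<dots> = {- y | y. y \<in> serial_connection i j u}"
    unfolding serial_connection_def by blast
  finally show "serial_connection i j (- u) = {- y | y. y \<in> serial_connection i j u}" .
qed

theorem theorem10p2:
  fixes i j k :: "(real \<Rightarrow> bool) \<Rightarrow> (real \<Rightarrow> bool) set"
  assumes "delay_condition i" and "delay_condition j"
    and "k = serial_connection i j"
  shows "delay_condition k
    \<and> (deterministic i \<and> deterministic j \<longrightarrow> deterministic k)
    \<and> (time_invariant i \<and> time_invariant j \<longrightarrow> time_invariant k)
    \<and> (symmetrical i \<and> symmetrical j \<longrightarrow> symmetrical k)"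
  using assms delay_condition_serial_connection deterministic_serial_connection
    time_invariant_serial_connection symmetrical_serial_connection
  by blast

end
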